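(* Let $n\ge 2$, let $\omega_1,\ldots,\omega_n\in\mathbb{D}$, and let $T_n\in\mathcal{M}_n(\mathbb{C})$ be an upper triangular matrix $$T_n = \begin{pmatrix} \omega_1 & \alpha_1^{(1)} & \alpha_1^{(2)} & \cdots & \cdots & \alpha_1^{(n-1)} \\ 0 & \omega_2 & \alpha_2^{(1)} & \alpha_2^{(2)} & & \vdots \\ \vdots & & \ddots & \ddots & \ddots & \vdots \\ & & & & & \alpha_{n-2}^{(2)} \\ & & & & & \alpha_{n-1}^{(1)} \\ 0 & \cdots & \cdots & \cdots & 0 & \omega_n \end{pmatrix},$$ that is, $[T_n]_{i,i}=\omega_i$ for $1\le i\le n$, $[T_n]_{i,i+j}=\alpha_i^{(j)}\in\mathbb{C}$ for $1\le i\le n-1$ and $1\le j\le n-i$, and $[T_n]_{i,j}=0$ for $i>j$. Assume that $$\alpha_i^{(1)}=\sqrt{1-|\omega_i|^2}\,\sqrt{1-|\omega_{i+1}|^2}\quad\text{for all } 1\le i\le n-1.$$ Then $T_n$ is a contraction if and only if $T_n=M_n$, where $M_n=M_n(\omega_1,\ldots,\omega_n)\in\mathcal{M}_n(\mathbb{C})$ is the matrix defined by $$[M_n]_{i,j}=\begin{cases}\omega_j & \text{if } i=j,\\ \left(\prod_{k=i+1}^{j-1}(-\overline{\omega_k})\right)\sqrt{1-|\omega_i|^2}\,\sqrt{1-|\omega_j|^2} & \text{if } i<j,\\ 0 & \text{if } i>j.\end{cases}$$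
   Context: $\mathbb{D}$ is the open unit disk in $\mathbb{C}$, and $\mathcal{M}_n(\mathbb{C})$ is the set of $n\times n$ complex matrices. A matrix $T\in\mathcal{M}_n(\mathbb{C})$ is a contraction if $\|T\|\le 1$, where $\|\cdot\|$ is the operator norm induced by the standard Euclidean (Hermitian) norm on $\mathbb{C}^n$ (the spectral norm). An empty product equals $1$. *)

theory Defs
  imports "HOL-Analysis.L2_Norm" "Jordan_Normal_Form.Matrix"
begin

definition euclid_norm :: "complex vec \<Rightarrow> real" where
  "euclid_norm v = L2_set (\<lambda>i. cmod (v $ i)) {0..<dim_vec v}"

definition spectral_norm :: "complex mat \<Rightarrow> real" where
  "spectral_norm A =
     (SUP v \<in> {v \<in> carrier_vec (dim_col A). euclid_norm v \<le> 1}. euclid_norm (A *\<^sub>v v))"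

definition contraction :: "complex mat \<Rightarrow> bool" where
  "contraction A \<longleftrightarrow> spectral_norm A \<le> 1"

definition M_entry :: "(nat \<Rightarrow> complex) \<Rightarrow> nat \<Rightarrow> nat \<Rightarrow> complex" where
  "M_entry \<omega> i j =
     (if i = j then \<omega> j
      else if i < j then
        (\<Prod>k\<in>{i<..<j}. - cnj (\<omega> k)) *
        of_real (sqrt (1 - (cmod (\<omega> i))\<^sup>2)) * of_real (sqrt (1 - (cmod (\<omega> j))\<^sup>2))
      else 0)"

(* Matrices are indexed from 0 here, whereas omega and M_entry are indexed from 1. *)
definition M_mat :: "nat \<Rightarrow> (nat \<Rightarrow> complex) \<Rightarrow> complex mat" where
  "M_mat n \<omega> = mat n n (\<lambda>(r, c). M_entry \<omega> (r + 1) (c + 1))"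

(* The supremum defining spectral_norm is over a nonempty set that is bounded above, so it is
   a genuine supremum and not an unspecified value of Sup on the reals. *)
lemma spectral_norm_dom_nonempty:
  "{v \<in> carrier_vec (dim_col A). euclid_norm v \<le> 1} \<noteq> {}"
proof -
  have "0\<^sub>v (dim_col A) \<in> {v \<in> carrier_vec (dim_col A). euclid_norm v \<le> 1}"
    by (auto simp: euclid_norm_def L2_set_def)
  then show ?thesis by blast
qed

lemma spectral_norm_bdd_above:
  "bdd_above ((\<lambda>v. euclid_norm (A *\<^sub>v v)) `
     {v \<in> carrier_vec (dim_col A). euclid_norm v \<le> 1})"
proof (rule bdd_aboveI2)
  fix v assume "v \<in> {v \<in> carrier_vec (dim_col A). euclid_norm v \<le> 1}"
  then have d: "dim_vec v = dim_col A" and v: "euclid_norm v \<le> 1" by auto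
  have le1: "cmod (v $ j) \<le> 1" if "j < dim_col A" for j
    using member_le_L2_set[of "{0..<dim_vec v}" j "\<lambda>i. cmod (v $ i)"] that d v
    by (auto simp: euclid_norm_def)
  have entry: "cmod ((A *\<^sub>v v) $ i) \<le> (\<Sum>j<dim_col A. cmod (A $$ (i, j)))"
    if i: "i < dim_row A" for i
  proof -
    have "(A *\<^sub>v v) $ i = (\<Sum>j<dim_col A. A $$ (i, j) * v $ j)"
      using i d by (simp add: scalar_prod_def atLeast0LessThan)
    then have "cmod ((A *\<^sub>v v) $ i) \<le> (\<Sum>j<dim_col A. cmod (A $$ (i, j) * v $ j))"
      by (simp add: norm_sum)
    also have "\<dots> \<le> (\<Sum>j<dim_col A. cmod (A $$ (i, j)))"
      by (intro sum_mono) (simp add: norm_mult le1 mult_left_le)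
    finally show ?thesis .
  qed
  have "euclid_norm (A *\<^sub>v v) \<le> (\<Sum>i = 0..<dim_row A. cmod ((A *\<^sub>v v) $ i))"
    unfolding euclid_norm_def dim_mult_mat_vec by (rule L2_set_le_sum) simp
  also have "\<dots> \<le> (\<Sum>i = 0..<dim_row A. \<Sum>j<dim_col A. cmod (A $$ (i, j)))"
    by (intro sum_mono entry) simp
  finally show "euclid_norm (A *\<^sub>v v) \<le> (\<Sum>i = 0..<dim_row A. \<Sum>j<dim_col A. cmod (A $$ (i, j)))" .
qed

end

theory Submission
  imports Defs
begin

text \<open>
  Write \<open>d\<^sub>i = sqrt (1 - |\<omega>\<^sub>i|\<^sup>2)\<close>. The matrix \<open>M\<close> is a cascade of unitary \<open>2 \<times> 2\<close> blocks: if \<open>y = M x\<close>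
  and \<open>s\<^sub>i = (\<Sum>j>i. (\<Prod>i<k<j. - cnj \<omega>\<^sub>k) d\<^sub>j x\<^sub>j)\<close>, then \<open>y\<^sub>i = \<omega>\<^sub>i x\<^sub>i + d\<^sub>i s\<^sub>i\<close> and
  \<open>s\<^sub>i\<^sub>-\<^sub>1 = d\<^sub>i x\<^sub>i - cnj \<omega>\<^sub>i s\<^sub>i\<close>, so \<open>|y\<^sub>i|\<^sup>2 + |s\<^sub>i\<^sub>-\<^sub>1|\<^sup>2 = |x\<^sub>i|\<^sup>2 + |s\<^sub>i|\<^sup>2\<close>. Telescoping gives
  \<open>(\<Sum>l>i. |y\<^sub>l|\<^sup>2) + |s\<^sub>i|\<^sup>2 = (\<Sum>l>i. |x\<^sub>l|\<^sup>2)\<close>, and \<open>i = 0\<close> shows that \<open>M\<close> is a contraction.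

  Conversely, the entries of a contraction \<open>T\<close> are determined diagonal by diagonal. To find \<open>T\<^sub>i\<^sub>j\<close> with
  \<open>j \<ge> i + 2\<close>, take \<open>x\<close> supported on \<open>{i + 1, j}\<close> with \<open>x\<^sub>j = 1\<close> and \<open>x\<^sub>i\<^sub>+\<^sub>1\<close> chosen so that \<open>s\<^sub>i = 0\<close>.
  The rows of \<open>T x\<close> below \<open>i\<close> agree with those of \<open>M x\<close> and already carry the whole norm of \<open>x\<close>,
  hence \<open>0 = (T x)\<^sub>i = T\<^sub>i\<^sub>j - M\<^sub>i\<^sub>j\<close>.
\<close>

section \<open>Contractions as maps that do not increase the norm\<close>

lemma euclid_norm_smult: "euclid_norm (c \<cdot>\<^sub>v v) = cmod c * euclid_norm v"
  by (auto simp: euclid_norm_def norm_mult L2_set_right_distrib intro!: L2_set_cong)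

text \<open>By homogeneity, the bound on the unit ball reaches every nonzero vector after division
  by its norm.\<close>

lemma contraction_iff:
  assumes A: "A \<in> carrier_mat m n"
  shows "contraction A \<longleftrightarrow> (\<forall>v\<in>carrier_vec n. euclid_norm (A *\<^sub>v v) \<le> euclid_norm v)"
proof
  assume "contraction A"
  have unit: "euclid_norm (A *\<^sub>v u) \<le> 1" if "u \<in> carrier_vec n" "euclid_norm u \<le> 1" for u
  proof -
    have "euclid_norm (A *\<^sub>v u) \<le> spectral_norm A"
      unfolding spectral_norm_def
      by (rule cSUP_upper[OF _ spectral_norm_bdd_above]) (use A that in auto)
    with \<open>contraction A\<close> show ?thesis by (simp add: contraction_def)
  qed
  show "\<forall>v\<in>carrier_vec n. euclid_norm (A *\<^sub>v v) \<le> euclid_norm v"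
  proof
    fix v :: "complex vec" assume v: "v \<in> carrier_vec n"
    have nn: "euclid_norm v \<ge> 0" by (simp add: euclid_norm_def)
    show "euclid_norm (A *\<^sub>v v) \<le> euclid_norm v"
    proof (cases "euclid_norm v = 0")
      case True
      then have "v = 0\<^sub>v n"
        using v by (intro eq_vecI) (auto simp: euclid_norm_def L2_set_eq_0_iff)
      then have "A *\<^sub>v v = 0\<^sub>v m" using A by auto
      then show ?thesis using nn by (simp add: euclid_norm_def L2_set_def)
    next
      case False
      let ?c = "complex_of_real (inverse (euclid_norm v))"
      have "euclid_norm (A *\<^sub>v (?c \<cdot>\<^sub>v v)) \<le> 1"
        by (rule unit) (use v nn False in \<open>auto simp: euclid_norm_smult norm_inverse\<close>)
      also have "A *\<^sub>v (?c \<cdot>\<^sub>v v) = ?c \<cdot>\<^sub>v (A *\<^sub>v v)"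
        using A v by (rule mult_mat_vec)
      finally show ?thesis
        using nn False by (simp add: euclid_norm_smult norm_inverse norm_divide field_simps)
    qed
  qed
next
  assume "\<forall>v\<in>carrier_vec n. euclid_norm (A *\<^sub>v v) \<le> euclid_norm v"
  then show "contraction A"
    unfolding contraction_def spectral_norm_def
    by (intro cSUP_least spectral_norm_dom_nonempty) (use A in fastforce)
qed

text \<open>Bridges the 0-based indices of vectors and matrices and the 1-based indices of \<omega>
  and \<open>M_entry\<close>.\<close>

lemma sum_lessThan_pred:
  "(\<Sum>i = 0..<n. f i) = (\<Sum>i = 1..n. f (i - 1 :: nat))"
  by (rule sum.reindex_bij_witness[of _ "\<lambda>i. i - 1" Suc]) auto

lemma euclid_norm_sq:
  assumes "v \<in> carrier_vec n"
  shows "(euclid_norm v)\<^sup>2 = (\<Sum>i = 1..n. (cmod (v $ (i - 1)))\<^sup>2)"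
  using assms by (simp add: euclid_norm_def L2_set_def sum_nonneg sum_lessThan_pred)

lemma euclid_norm_mult_mat_vec_sq:
  assumes A: "A \<in> carrier_mat n n" and v: "v \<in> carrier_vec n"
  shows "(euclid_norm (A *\<^sub>v v))\<^sup>2 =
    (\<Sum>i = 1..n. (cmod (\<Sum>j = 1..n. A $$ (i - 1, j - 1) * v $ (j - 1)))\<^sup>2)"
proof -
  have "(euclid_norm (A *\<^sub>v v))\<^sup>2 = (\<Sum>i = 1..n. (cmod ((A *\<^sub>v v) $ (i - 1)))\<^sup>2)"
    by (rule euclid_norm_sq) (use A v in auto)
  also have "\<dots> = (\<Sum>i = 1..n. (cmod (\<Sum>j = 1..n. A $$ (i - 1, j - 1) * v $ (j - 1)))\<^sup>2)"
  proof (rule sum.cong[OF refl])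
    fix i assume "i \<in> {1..n}"
    then have "(A *\<^sub>v v) $ (i - 1) = (\<Sum>j = 0..<n. A $$ (i - 1, j) * v $ j)"
      using A v by (auto simp: scalar_prod_def intro!: sum.cong)
    then show "(cmod ((A *\<^sub>v v) $ (i - 1)))\<^sup>2
        = (cmod (\<Sum>j = 1..n. A $$ (i - 1, j - 1) * v $ (j - 1)))\<^sup>2"
      by (simp only: sum_lessThan_pred)
  qed
  finally show ?thesis .
qed

section \<open>The cascade of unitary blocks behind \<open>M_mat\<close>\<close>

definition defect :: "complex \<Rightarrow> real" where
  "defect w = sqrt (1 - (cmod w)\<^sup>2)"

text \<open>This is \<open>s\<^sub>i\<close> from above: the state that the rows below
  \<open>i\<close> hand up to row \<open>i\<close>.\<close>

definition tail_state :: "nat \<Rightarrow> (nat \<Rightarrow> complex) \<Rightarrow> (nat \<Rightarrow> complex) \<Rightarrow> nat \<Rightarrow> complex" where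
  "tail_state n \<omega> x i =
     (\<Sum>j\<in>{i<..n}. (\<Prod>k\<in>{i<..<j}. - cnj (\<omega> k)) * of_real (defect (\<omega> j)) * x j)"

lemma defect_sq:
  assumes "cmod w \<le> 1"
  shows "(defect w)\<^sup>2 = 1 - (cmod w)\<^sup>2"
  using assms by (simp add: defect_def power_le_one)

lemma defect_pos:
  assumes "cmod w < 1"
  shows "defect w > 0"
  using assms by (simp add: defect_def abs_square_less_1)

text \<open>The term at \<open>Suc i\<close> has an empty product; all later terms share the factor
  \<open>- cnj (\<omega> (Suc i))\<close>.\<close>

lemma tail_state_rec:
  assumes "i < n"
  shows "tail_state n \<omega> x i =
    of_real (defect (\<omega> (Suc i))) * x (Suc i) - cnj (\<omega> (Suc i)) * tail_state n \<omega> x (Suc i)"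
proof -
  have split: "{i<..n} = insert (Suc i) {Suc i<..n}" using assms by auto
  have prod: "(\<Prod>k\<in>{i<..<j}. - cnj (\<omega> k)) = - cnj (\<omega> (Suc i)) * (\<Prod>k\<in>{Suc i<..<j}. - cnj (\<omega> k))"
    if "j \<in> {Suc i<..n}" for j
  proof -
    have "{i<..<j} = insert (Suc i) {Suc i<..<j}" using that by auto
    then show ?thesis by simp
  qed
  have "{i<..<Suc i} = {}" by auto
  then show ?thesis
    unfolding tail_state_def split
    by (simp add: prod sum_distrib_left mult.assoc sum_negf)
qed

lemma M_entry_row_sum:
  assumes "1 \<le> i" "i \<le> n"
  shows "(\<Sum>j = 1..n. M_entry \<omega> i j * x j) =
    \<omega> i * x i + of_real (defect (\<omega> i)) * tail_state n \<omega> x i"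
proof -
  have "(\<Sum>j = 1..n. M_entry \<omega> i j * x j) = (\<Sum>j\<in>insert i {i<..n}. M_entry \<omega> i j * x j)"
    by (rule sum.mono_neutral_right) (use assms in \<open>auto simp: M_entry_def\<close>)
  also have "\<dots> = \<omega> i * x i + (\<Sum>j\<in>{i<..n}. M_entry \<omega> i j * x j)"
    by (simp add: M_entry_def)
  also have "(\<Sum>j\<in>{i<..n}. M_entry \<omega> i j * x j) = of_real (defect (\<omega> i)) * tail_state n \<omega> x i"
    by (simp add: tail_state_def sum_distrib_left M_entry_def defect_def mult_ac)
  finally show ?thesis .
qed

text \<open>The matrix with rows \<open>(w, d)\<close> and \<open>(d, - cnj w)\<close> is unitary when \<open>d = defect w\<close>.\<close>
lemma elementary_block_isometry:
  assumes "cmod w \<le> 1"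
  shows "(cmod (w * x + of_real (defect w) * s))\<^sup>2 + (cmod (of_real (defect w) * x - cnj w * s))\<^sup>2
    = (cmod x)\<^sup>2 + (cmod s)\<^sup>2"
proof -
  \<comment> \<open>The conjugates become independent variables \<open>w'\<close>,
    \<open>x'\<close>, \<open>s'\<close>, and the real \<open>d\<close> is its own conjugate, so the
    norm identity turns into a polynomial one.\<close>
  have ring: "(w * x + d * s) * (w' * x' + d * s') + (d * x - w' * s) * (d * x' - w * s')
      = (w * w' + d\<^sup>2) * (x * x' + s * s')" for d w' x' s' :: complex
    by (simp add: algebra_simps power2_eq_square)
  have "complex_of_real ((cmod (w * x + of_real (defect w) * s))\<^sup>2
        + (cmod (of_real (defect w) * x - cnj w * s))\<^sup>2)
      = of_real (((cmod w)\<^sup>2 + (defect w)\<^sup>2) * ((cmod x)\<^sup>2 + (cmod s)\<^sup>2))"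
    unfolding of_real_add of_real_mult complex_norm_square
    by (simp only: complex_cnj_add complex_cnj_diff complex_cnj_mult complex_cnj_complex_of_real
          complex_cnj_cnj of_real_power ring)
  also have "(cmod w)\<^sup>2 + (defect w)\<^sup>2 = 1" using defect_sq[OF assms] by simp
  finally show ?thesis by (simp only: of_real_eq_iff mult_1)
qed

text \<open>Downward induction from \<open>i = n\<close>, where the sums are empty and the state is
  0; each step adds one isometric block.\<close>

lemma M_entry_energy_balance:
  assumes "i \<le> n" and "\<And>l. i < l \<Longrightarrow> l \<le> n \<Longrightarrow> cmod (\<omega> l) \<le> 1"
  shows "(\<Sum>l\<in>{i<..n}. (cmod (\<Sum>j = 1..n. M_entry \<omega> l j * x j))\<^sup>2) + (cmod (tail_state n \<omega> x i))\<^sup>2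
    = (\<Sum>l\<in>{i<..n}. (cmod (x l))\<^sup>2)"
  using assms
proof (induction i rule: inc_induct)
  case base
  then show ?case by (simp add: tail_state_def)
next
  case (step i)
  have split: "{i<..n} = insert (Suc i) {Suc i<..n}" using step.hyps by auto
  have "(\<Sum>l\<in>{Suc i<..n}. (cmod (\<Sum>j = 1..n. M_entry \<omega> l j * x j))\<^sup>2)
      + (cmod (tail_state n \<omega> x (Suc i)))\<^sup>2 = (\<Sum>l\<in>{Suc i<..n}. (cmod (x l))\<^sup>2)"
    using step.prems by (intro step.IH) auto
  moreover have "(\<Sum>j = 1..n. M_entry \<omega> (Suc i) j * x j) =
      \<omega> (Suc i) * x (Suc i) + of_real (defect (\<omega> (Suc i))) * tail_state n \<omega> x (Suc i)"
    by (rule M_entry_row_sum) (use step.hyps in auto)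
  moreover have "cmod (\<omega> (Suc i)) \<le> 1" using step by auto
  note elementary_block_isometry[OF this, of "x (Suc i)" "tail_state n \<omega> x (Suc i)"]
  ultimately show ?case
    unfolding split tail_state_rec[OF step.hyps(2)] by simp
qed

lemma contraction_M_mat:
  assumes "\<And>l. 1 \<le> l \<Longrightarrow> l \<le> n \<Longrightarrow> cmod (\<omega> l) \<le> 1"
  shows "contraction (M_mat n \<omega>)"
proof -
  have M: "M_mat n \<omega> \<in> carrier_mat n n" by (simp add: M_mat_def)
  have "euclid_norm (M_mat n \<omega> *\<^sub>v v) \<le> euclid_norm v" if v: "v \<in> carrier_vec n" for v
  proof (rule power2_le_imp_le)
    have "(euclid_norm (M_mat n \<omega> *\<^sub>v v))\<^sup>2
        = (\<Sum>i = 1..n. (cmod (\<Sum>j = 1..n. M_entry \<omega> i j * v $ (j - 1)))\<^sup>2)"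
      unfolding euclid_norm_mult_mat_vec_sq[OF M v]
      by (intro sum.cong arg_cong[where f = "\<lambda>z. (cmod z)\<^sup>2"] refl) (auto simp: M_mat_def)
    also have "\<dots> \<le> (\<Sum>i = 1..n. (cmod (v $ (i - 1)))\<^sup>2)"
    proof -
      have "{0<..n} = {1..n}" by auto
      then show ?thesis
        using M_entry_energy_balance[of 0 n \<omega> "\<lambda>j. v $ (j - 1)"] assms
        by (smt (verit) Suc_leI One_nat_def le0 sum.cong zero_le_power2)
    qed
    also have "\<dots> = (euclid_norm v)\<^sup>2" by (rule euclid_norm_sq[OF v, symmetric])
    finally show "(euclid_norm (M_mat n \<omega> *\<^sub>v v))\<^sup>2 \<le> (euclid_norm v)\<^sup>2" .
  qed (simp add: euclid_norm_def)
  then show ?thesis using contraction_iff[OF M] by blast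
qed

section \<open>Rigidity: a contraction is determined diagonal by diagonal\<close>

lemma contraction_entry_eq_M_entry:
  assumes T: "T \<in> carrier_mat n n" and "contraction T"
    and \<omega>: "\<And>l. 1 \<le> l \<Longrightarrow> l \<le> n \<Longrightarrow> cmod (\<omega> l) < 1"
    and ij: "1 \<le> i" "Suc i < j" "j \<le> n"
    and near: "\<And>p q. 1 \<le> p \<Longrightarrow> p \<le> n \<Longrightarrow> 1 \<le> q \<Longrightarrow> q \<le> n \<Longrightarrow> q < p + (j - i) \<Longrightarrow>
      T $$ (p - 1, q - 1) = M_entry \<omega> p q"
  shows "T $$ (i - 1, j - 1) = M_entry \<omega> i j"
proof -
  let ?d = "\<lambda>l. complex_of_real (defect (\<omega> l))"
  define P where "P = (\<Prod>k\<in>{i<..<j}. - cnj (\<omega> k))"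
  \<comment> \<open>Solves \<open>?d (Suc i) * a + P * ?d j = 0\<close>, whose left side is
    \<open>tail_state n \<omega> x i\<close>.\<close>
  define a where "a = - (P * ?d j) / ?d (Suc i)"
  define x where "x l = (if l = Suc i then a else if l = j then 1 else 0)" for l
  define v where "v = vec n (\<lambda>l. x (Suc l))"
  define r where "r l = (\<Sum>m = 1..n. T $$ (l - 1, m - 1) * x m)" for l
  have v: "v \<in> carrier_vec n" by (simp add: v_def)
  have vx: "v $ (l - 1) = x l" if "l \<in> {1..n}" for l
    using that by (auto simp: v_def)
  have d0: "?d (Suc i) \<noteq> 0" using defect_pos[OF \<omega>[of "Suc i"]] ij by simp
  have two: "(\<Sum>l\<in>S. f l * x l) = f (Suc i) * a + f j"
    if "finite S" "Suc i \<in> S" "j \<in> S" for f S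
  proof -
    have "(\<Sum>l\<in>S. f l * x l) = (\<Sum>l\<in>{Suc i, j}. f l * x l)"
      by (rule sum.mono_neutral_right) (use that in \<open>auto simp: x_def\<close>)
    then show ?thesis using ij by (simp add: x_def)
  qed
  have "{i<..<Suc i} = {}" by auto
  then have s0: "tail_state n \<omega> x i = 0"
    unfolding tail_state_def
    by (subst two) (use ij d0 in \<open>auto simp: a_def P_def\<close>)
  \<comment> \<open>Below row \<open>i\<close>, the columns up to \<open>j\<close> fall under
    \<open>near\<close>, and \<open>x\<close> vanishes on the columns beyond
    \<open>j\<close>.\<close>
  have row: "r l = (\<Sum>m = 1..n. M_entry \<omega> l m * x m)" if l: "l \<in> {i<..n}" for l
    unfolding r_def
  proof (rule sum.cong[OF refl])
    fix m assume m: "m \<in> {1..n}"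
    show "T $$ (l - 1, m - 1) * x m = M_entry \<omega> l m * x m"
    proof (cases "m \<le> j")
      case True
      then have "m < l + (j - i)" using l ij by auto
      then show ?thesis using near[of l m] l m by simp
    next
      case False
      then show ?thesis using ij by (simp add: x_def)
    qed
  qed
  have ri: "r i = T $$ (i - 1, j - 1) - M_entry \<omega> i j"
  proof -
    have "r i = T $$ (i - 1, Suc i - 1) * a + T $$ (i - 1, j - 1)"
      unfolding r_def by (rule two) (use ij in auto)
    also have "T $$ (i - 1, Suc i - 1) = M_entry \<omega> i (Suc i)"
      by (rule near) (use ij in auto)
    \<comment> \<open>The factor \<open>?d (Suc i)\<close> of the superdiagonal entry cancels the
      denominator of \<open>a\<close>.\<close>
    also have "M_entry \<omega> i (Suc i) * a = - M_entry \<omega> i j"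
      using ij d0 \<open>{i<..<Suc i} = {}\<close>
      by (simp add: M_entry_def a_def P_def defect_def[symmetric])
    finally show ?thesis by simp
  qed
  have below: "(\<Sum>l\<in>{i<..n}. (cmod (r l))\<^sup>2) = (\<Sum>l\<in>{i<..n}. (cmod (x l))\<^sup>2)"
    using M_entry_energy_balance[of i n \<omega> x] s0 row ij \<omega> by (simp add: less_imp_le)
  \<comment> \<open>The rows after \<open>i\<close> already exhaust the norm of \<open>x\<close> by
    \<open>below\<close>, so contractivity leaves nothing for row \<open>i\<close>.\<close>
  have "(cmod (r i))\<^sup>2 + (\<Sum>l\<in>{i<..n}. (cmod (r l))\<^sup>2) = (\<Sum>l\<in>insert i {i<..n}. (cmod (r l))\<^sup>2)"
    by simp
  also have "\<dots> \<le> (\<Sum>l = 1..n. (cmod (r l))\<^sup>2)"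
    by (rule sum_mono2) (use ij in auto)
  also have "\<dots> = (euclid_norm (T *\<^sub>v v))\<^sup>2"
    unfolding euclid_norm_mult_mat_vec_sq[OF T v] r_def by (simp only: vx cong: sum.cong)
  also have "\<dots> \<le> (euclid_norm v)\<^sup>2"
    using \<open>contraction T\<close> v
    by (intro power_mono) (auto simp: contraction_iff[OF T] euclid_norm_def)
  also have "\<dots> = (\<Sum>l = 1..n. (cmod (x l))\<^sup>2)"
    unfolding euclid_norm_sq[OF v] by (simp only: vx cong: sum.cong)
  also have "\<dots> = (\<Sum>l\<in>{i<..n}. (cmod (x l))\<^sup>2)"
    by (rule sum.mono_neutral_right) (use ij in \<open>auto simp: x_def\<close>)
  finally have "r i = 0" using below by simp
  with ri show ?thesis by simp
qed

theorem theorem1p1: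
  fixes n :: nat
    and \<omega> :: "nat \<Rightarrow> complex"
    and \<alpha> :: "nat \<Rightarrow> nat \<Rightarrow> complex"
    and T :: "complex mat"
  assumes "n \<ge> 2"
    and "\<And>i. 1 \<le> i \<Longrightarrow> i \<le> n \<Longrightarrow> cmod (\<omega> i) < 1"
    and "T \<in> carrier_mat n n"
    and "\<And>i. 1 \<le> i \<Longrightarrow> i \<le> n \<Longrightarrow> T $$ (i - 1, i - 1) = \<omega> i"
    and "\<And>i j. 1 \<le> i \<Longrightarrow> i \<le> n - 1 \<Longrightarrow> 1 \<le> j \<Longrightarrow> j \<le> n - i \<Longrightarrow>
           T $$ (i - 1, i + j - 1) = \<alpha> i j"
    and "\<And>i j. 1 \<le> j \<Longrightarrow> j < i \<Longrightarrow> i \<le> n \<Longrightarrow> T $$ (i - 1, j - 1) = 0"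
    and "\<And>i. 1 \<le> i \<Longrightarrow> i \<le> n - 1 \<Longrightarrow>
           \<alpha> i 1 = of_real (sqrt (1 - (cmod (\<omega> i))\<^sup>2) * sqrt (1 - (cmod (\<omega> (i + 1)))\<^sup>2))"
  shows "contraction T \<longleftrightarrow> T = M_mat n \<omega>"
proof
  assume "contraction T"
  have entry: "T $$ (i - 1, j - 1) = M_entry \<omega> i j"
    if "1 \<le> i" "i \<le> n" "1 \<le> j" "j \<le> n" for i j
    using that
  \<comment> \<open>Truncated subtraction gives measure 0 to all entries on or below the diagonal,
    so in the last case \<open>less.hyps\<close> also covers the lower triangle.\<close>
  proof (induction "j - i" arbitrary: i j rule: less_induct)
    case less
    consider "j < i" | "j = i" | "j = Suc i" | "Suc i < j" by linarith
    then show ?case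
    proof cases
      case 1
      then show ?thesis using assms(6) less.prems by (simp add: M_entry_def)
    next
      case 2
      then show ?thesis using assms(4) less.prems by (simp add: M_entry_def)
    next
      case 3
      moreover have "{i<..<Suc i} = {}" by auto
      ultimately show ?thesis
        using assms(5)[of i 1] assms(7)[of i] less.prems by (simp add: M_entry_def)
    next
      case 4
      show ?thesis
      proof (rule contraction_entry_eq_M_entry[OF assms(3) \<open>contraction T\<close> assms(2)])
        fix p q assume "1 \<le> p" "p \<le> n" "1 \<le> q" "q \<le> n" "q < p + (j - i)"
        then show "T $$ (p - 1, q - 1) = M_entry \<omega> p q"
          using 4 by (intro less.hyps) auto
      qed (use 4 less.prems in auto)
    qed
  qed
  show "T = M_mat n \<omega>"
  proof (rule eq_matI)
    fix r c assume "r < dim_row (M_mat n \<omega>)" "c < dim_col (M_mat n \<omega>)"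
    then show "T $$ (r, c) = M_mat n \<omega> $$ (r, c)"
      using entry[of "r + 1" "c + 1"] by (simp add: M_mat_def)
  qed (use assms(3) in \<open>auto simp: M_mat_def\<close>)
next
  assume "T = M_mat n \<omega>"
  then show "contraction T" using contraction_M_mat assms(2) by (simp add: less_imp_le)
qed

end
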